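(* For any $y\in\mathbb R^3$, the derivative matrix $X'(y)$ satisfies $$c_6\chi_1^{-1}(1+|y|)^{-a}\le |X'(y)|\le c_7(1+\chi_1)^a(1+|y|)^{-a},$$ $$\xi^{\rm T}X'(y)\xi\ge c_8\chi_1^{-2}(1+|y|)^{-a}|\xi|^2\quad\text{for all }\xi\in\mathbb R^3,$$ where $$c_6=\frac{\sqrt3\,(2^{-\alpha_N}\min\{1,a_N\})^a}{\alpha_N+2},\quad c_7=\frac{c_*2^{\alpha_N}}{\min\{a_0,a_N\}},\quad c_8=\frac{c_4}{(\alpha_N+2)^2},\quad c_4=\Big(\frac{\min\{1,a_0,a_N\}}{2^{\alpha_N}}\Big)^{1+a}.$$
   Context: $N\ge1$ is an integer, $0=\alpha_0<\alpha_1<\dots<\alpha_N$ are real numbers, $a_0,\dots,a_N>0$ are constants, and $g(s)=\sum_{i=0}^N a_is^{\alpha_i}$ for $s\ge0$. $\vec k\in\mathbb R^3$ is a fixed unit vector, $\mathbf J$ is the $3\times3$ matrix with $\mathbf Jx=\vec k\times x$ for all $x\in\mathbb R^3$, and $\mathcal R\ge0$ is a constant. The function $F:\mathbb R^3\to\mathbb R^3$, $F(v)=g(|v|)v+\mathcal R\,\mathbf Jv$, is a $C^1$ bijection whose inverse $X=F^{-1}$ is also $C^1$; $X'(y)$ is its $3\times3$ derivative matrix. Further, $a=\frac{\alpha_N}{1+\alpha_N}\in(0,1)$, $\chi_0=g(1)=\sum_{i=0}^Na_i$ and $\chi_1=\chi_0+\mathcal R$. For a $3\times3$ real matrix $\mathbf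 A=(a_{ij})$, $|\mathbf A|=(\sum_{i,j}a_{ij}^2)^{1/2}$ is the Euclidean (Frobenius) norm and $\|\mathbf A\|_{\rm op}=\max_{|x|=1}|\mathbf Ax|$; $c_*>0$ is a constant independent of $\mathbf A$ such that $|\mathbf A|\le c_*\|\mathbf A\|_{\rm op}$ for all $3\times3$ real matrices $\mathbf A$. *)

theory Defs
  imports "HOL-Analysis.Analysis"
begin

(* Power of a nonnegative base with s^0 = 1 also at s = 0; the library has 0 powr 0 = 0. *)
definition rpow :: "real \<Rightarrow> real \<Rightarrow> real" where
  "rpow s p = (if p = 0 then 1 else s powr p)"

definition g_poly :: "nat \<Rightarrow> (nat \<Rightarrow> real) \<Rightarrow> (nat \<Rightarrow> real) \<Rightarrow> real \<Rightarrow> real" where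
  "g_poly N \<alpha> a s = (\<Sum>i\<le>N. a i * rpow s (\<alpha> i))"

definition J_mat :: "real^3 \<Rightarrow> real^3^3" where
  "J_mat k = matrix (cross3 k)"

lemma J_mat_mult: "J_mat k *v x = cross3 k x"
proof -
  have "linear (cross3 k)"
    by (intro linearI) (simp_all add: cross_add_right cross_mult_right)
  then show ?thesis
    by (simp add: J_mat_def matrix_works)
qed

definition F_map ::
  "nat \<Rightarrow> (nat \<Rightarrow> real) \<Rightarrow> (nat \<Rightarrow> real) \<Rightarrow> real \<Rightarrow> real^3 \<Rightarrow> real^3 \<Rightarrow> real^3" where
  "F_map N \<alpha> a R k v = g_poly N \<alpha> a (norm v) *\<^sub>R v + R *\<^sub>R (J_mat k *v v)"

definition X_map ::
  "nat \<Rightarrow> (nat \<Rightarrow> real) \<Rightarrow> (nat \<Rightarrow> real) \<Rightarrow> real \<Rightarrow> real^3 \<Rightarrow> real^3 \<Rightarrow> real^3" where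
  "X_map N \<alpha> a R k = inv (F_map N \<alpha> a R k)"

definition X_deriv ::
  "nat \<Rightarrow> (nat \<Rightarrow> real) \<Rightarrow> (nat \<Rightarrow> real) \<Rightarrow> real \<Rightarrow> real^3 \<Rightarrow> real^3 \<Rightarrow> real^3^3" where
  "X_deriv N \<alpha> a R k y = jacobian (X_map N \<alpha> a R k) (at y)"

(* The Euclidean (Frobenius) norm of a matrix is the norm of the type real^3^3. *)
lemma norm_mat_eq: "norm (A :: real^3^3) = sqrt (\<Sum>i\<in>UNIV. \<Sum>j\<in>UNIV. (A $ i $ j)\<^sup>2)"
  by (simp add: norm_vec_def L2_set_def sum_nonneg)

definition exp_a :: "nat \<Rightarrow> (nat \<Rightarrow> real) \<Rightarrow> real" where
  "exp_a N \<alpha> = \<alpha> N / (1 + \<alpha> N)"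

definition chi0 :: "nat \<Rightarrow> (nat \<Rightarrow> real) \<Rightarrow> (nat \<Rightarrow> real) \<Rightarrow> real" where
  "chi0 N \<alpha> a = g_poly N \<alpha> a 1"

lemma chi0_eq_sum: "chi0 N \<alpha> a = (\<Sum>i\<le>N. a i)"
  unfolding chi0_def g_poly_def rpow_def by (rule sum.cong) auto

definition chi1 :: "nat \<Rightarrow> (nat \<Rightarrow> real) \<Rightarrow> (nat \<Rightarrow> real) \<Rightarrow> real \<Rightarrow> real" where
  "chi1 N \<alpha> a R = chi0 N \<alpha> a + R"

definition c4 :: "nat \<Rightarrow> (nat \<Rightarrow> real) \<Rightarrow> (nat \<Rightarrow> real) \<Rightarrow> real" where
  "c4 N \<alpha> a = (min 1 (min (a 0) (a N)) / 2 powr (\<alpha> N)) powr (1 + exp_a N \<alpha>)"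

definition c6 :: "nat \<Rightarrow> (nat \<Rightarrow> real) \<Rightarrow> (nat \<Rightarrow> real) \<Rightarrow> real" where
  "c6 N \<alpha> a = sqrt 3 * (2 powr (- \<alpha> N) * min 1 (a N)) powr (exp_a N \<alpha>) / (\<alpha> N + 2)"

definition c7 :: "nat \<Rightarrow> (nat \<Rightarrow> real) \<Rightarrow> (nat \<Rightarrow> real) \<Rightarrow> real \<Rightarrow> real" where
  "c7 N \<alpha> a cs = cs * 2 powr (\<alpha> N) / min (a 0) (a N)"

definition c8 :: "nat \<Rightarrow> (nat \<Rightarrow> real) \<Rightarrow> (nat \<Rightarrow> real) \<Rightarrow> real" where
  "c8 N \<alpha> a = c4 N \<alpha> a / (\<alpha> N + 2)\<^sup>2"

end

theory Submission
  imports Defs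
begin

text \<open>
  Write \<open>v = X y\<close> and \<open>s = |v|\<close>. The derivative of \<open>F\<close> at \<open>v\<close> is
  \<open>g s I + R J + c v v\<^sup>T\<close> with \<open>0 \<le> c s\<^sup>2 \<le> \<alpha>\<^sub>N g s\<close>, so its symmetric part is at least \<open>g s\<close>
  and its operator norm is at most \<open>(1 + \<alpha>\<^sub>N) g s + R\<close>. Hence \<open>|X' y \<xi>|\<close> lies between
  \<open>|\<xi>| / ((1 + \<alpha>\<^sub>N) g s + R)\<close> and \<open>|\<xi>| / g s\<close>, while \<open>\<xi>\<^sup>T X' y \<xi> \<ge> g s |X' y \<xi>|\<^sup>2\<close>.
  What remains is to compare powers of \<open>1 + s\<close> and \<open>1 + |y|\<close>, using
  \<open>g s s \<le> |y| \<le> (g s + R) s\<close>.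
  Since \<open>F\<close> is strongly monotone it expands distances, so its range is closed; by invariance of
  domain the range is also open, whence \<open>F\<close> is bijective.
\<close>

section \<open>Inverting expanding maps\<close>

text \<open>Expansion pulls a convergent sequence in the range back to a Cauchy sequence of
  preimages, so the range is closed. Being also open and nonempty, it is everything by
  connectedness.\<close>

lemma expanding_imp_bij:
  fixes f :: "'a::euclidean_space \<Rightarrow> 'a"
  assumes cont: "continuous_on UNIV f" and "m > 0"
    and expand: "\<And>x y. m * dist x y \<le> dist (f x) (f y)"
  shows "bij f"
proof -
  have inj: "inj f"
  proof (rule injI)
    fix x y assume "f x = f y"
    then have "m * dist x y \<le> 0" using expand[of x y] by simp
    then show "x = y" using \<open>m > 0\<close> by (simp add: mult_le_0_iff)
  qed
  have "open (range f)"
    using invariance_of_domain[OF cont open_UNIV inj] .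
  moreover have "closed (range f)"
    unfolding closed_sequential_limits
  proof (intro allI impI, elim conjE)
    fix u l assume u: "\<forall>n. u n \<in> range f" and lim: "u \<longlonglongrightarrow> l"
    define x where "x n = inv f (u n)" for n
    have fx: "f (x n) = u n" for n
      using u by (simp add: x_def f_inv_into_f)
    have "Cauchy x"
    proof (rule metric_CauchyI)
      fix e :: real assume "e > 0"
      then obtain M where M: "\<forall>i\<ge>M. \<forall>j\<ge>M. dist (u i) (u j) < m * e"
        using metric_CauchyD[OF LIMSEQ_imp_Cauchy[OF lim], of "m * e"] \<open>m > 0\<close> by auto
      have "dist (x i) (x j) < e" if "i \<ge> M" "j \<ge> M" for i j
      proof -
        have "m * dist (x i) (x j) < m * e"
          using expand[of "x i" "x j"] M that by (fastforce simp: fx)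
        then show ?thesis using \<open>m > 0\<close> by simp
      qed
      then show "\<exists>M. \<forall>i\<ge>M. \<forall>j\<ge>M. dist (x i) (x j) < e" by blast
    qed
    then obtain z where z: "x \<longlonglongrightarrow> z"
      using Cauchy_convergent_iff convergent_def by blast
    have "(\<lambda>n. f (x n)) \<longlonglongrightarrow> f z"
      using cont z continuous_on_tendsto_compose[of UNIV f x z sequentially] by auto
    then show "l \<in> range f"
      using lim LIMSEQ_unique by (auto simp: fx)
  qed
  ultimately have "range f = UNIV"
    using clopen[of "range f"] by auto
  with inj show ?thesis by (simp add: bij_def)
qed

text \<open>The expansion bound makes \<open>inv f\<close> Lipschitz with constant 1/m, which gives
  the continuity required by the inverse derivative rule. In finite dimension the injective
  \<open>f'\<close> has a two-sided linear inverse.\<close>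

lemma expanding_inv_has_derivative:
  fixes f :: "'a::euclidean_space \<Rightarrow> 'a"
  assumes "bij f" and "m > 0"
    and expand: "\<And>x y. m * dist x y \<le> dist (f x) (f y)"
    and der: "(f has_derivative f') (at (inv f y))" and inj: "inj f'"
  obtains f'' where "(inv f has_derivative f'') (at y)" "\<And>x. f' (f'' x) = x"
proof -
  have lin: "linear f'"
    using der has_derivative_linear by blast
  obtain f'' where f'': "linear f''" "\<forall>x. f'' (f' x) = x" "\<forall>x. f' (f'' x) = x"
    using linear_injective_isomorphism[OF lin inj] by auto
  have surj: "f (inv f z) = z" for z
    using \<open>bij f\<close> by (simp add: bij_is_surj surj_f_inv_f)
  have "continuous (at y) (inv f)"
    unfolding continuous_at_eps_delta
  proof (intro allI impI)
    fix e :: real assume "e > 0"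
    have "dist (inv f z) (inv f y) < e" if "dist z y < m * e" for z
    proof -
      have "m * dist (inv f z) (inv f y) < m * e"
        using expand[of "inv f z" "inv f y"] that by (simp add: surj)
      then show ?thesis using \<open>m > 0\<close> by simp
    qed
    then show "\<exists>d>0. \<forall>z. dist z y < d \<longrightarrow> dist (inv f z) (inv f y) < e"
      using \<open>m > 0\<close> \<open>e > 0\<close> by (intro exI[of _ "m * e"]) auto
  qed
  then have "(inv f has_derivative f'') (at y)"
    using der f'' surj
    by (auto simp: linear_conv_bounded_linear fun_eq_iff
        intro: has_derivative_inverse_basic[where f = f and f' = f' and T = UNIV])
  with f'' that show thesis by blast
qed

section \<open>Generalized polynomials\<close>

lemma rpow_nonneg: "rpow s p \<ge> 0"
  by (simp add: rpow_def)

lemma rpow_mono: "0 \<le> p \<Longrightarrow> 0 \<le> s \<Longrightarrow> s \<le> t \<Longrightarrow> rpow s p \<le> rpow t p"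
  by (simp add: rpow_def powr_mono2)

text \<open>The base is enlarged to 1 + s because powers increase with the exponent only for bases
  at least 1.\<close>

lemma rpow_le_powr: "0 \<le> p \<Longrightarrow> p \<le> q \<Longrightarrow> 0 \<le> s \<Longrightarrow> rpow s p \<le> (1 + s) powr q"
  using powr_mono2[of p s "1 + s"] powr_mono[of p q "1 + s"]
  by (auto simp: rpow_def ge_one_powr_ge_zero)

lemma continuous_on_rpow: "0 \<le> p \<Longrightarrow> continuous_on {0..} (\<lambda>s. rpow s p)"
  by (cases "p = 0")
    (auto simp: rpow_def intro!: continuous_on_powr' continuous_on_id continuous_on_const)

text \<open>The quotient form of the derivative returns a multiple of \<open>rpow s p\<close> after
  multiplication by s, as needed to compare s g'(s) with g(s).\<close>

lemma rpow_has_real_derivative: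
  assumes "s > 0"
  shows "((\<lambda>s. rpow s p) has_real_derivative p * rpow s p / s) (at s)"
proof (cases "p = 0")
  case False
  then show ?thesis
    using has_real_derivative_powr[OF assms, of p] assms
    by (simp add: rpow_def powr_diff)
qed (simp add: rpow_def)

text \<open>Rests on 1 + s \<le> 2 max(1, s), so it also covers exponents below 1, which
  \<open>\<alpha> N\<close> may be.\<close>

lemma one_plus_powr_le:
  fixes s p :: real
  assumes "0 \<le> s" "0 \<le> p"
  shows "(1 + s) powr p \<le> 2 powr p * (1 + s powr p)"
proof -
  have "(1 + s) powr p \<le> (2 * max 1 s) powr p"
    using assms by (intro powr_mono2) auto
  also have "\<dots> = 2 powr p * max 1 s powr p"
    using assms by (simp add: powr_mult)
  also have "max 1 s powr p \<le> 1 + s powr p"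
    by (auto simp: max_def)
  finally show ?thesis by simp
qed

text \<open>Midpoint convexity between 1 and s saves a factor 2 over the crude bound. For p = 1 +
  \<open>\<alpha> N\<close> this gives exactly the power of 2 in \<open>c6\<close>.\<close>

lemma one_plus_powr_le_convex:
  fixes s p :: real
  assumes "0 \<le> s" "1 \<le> p"
  shows "(1 + s) powr p \<le> 2 powr (p - 1) * (1 + s powr p)"
proof (cases "s = 0")
  case True
  then show ?thesis using assms by (simp add: ge_one_powr_ge_zero)
next
  case False
  then have "((1 - 1/2) *\<^sub>R 1 + (1/2) *\<^sub>R s) powr p
      \<le> (1 - 1/2) * 1 powr p + (1/2) * s powr p"
    using assms by (intro convex_onD[OF powr_convex]) auto
  then have "((1 + s) / 2) powr p \<le> (1 + s powr p) / 2"
    by (simp add: field_simps)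
  moreover have "((1 + s) / 2) powr p = (1 + s) powr p / 2 powr p"
    using assms by (simp add: powr_divide)
  ultimately show ?thesis
    by (simp add: field_simps powr_diff)
qed

section \<open>Growth and logarithmic derivative of g\<close>

locale damped_polynomial =
  fixes N :: nat and \<alpha> a :: "nat \<Rightarrow> real"
  assumes alpha_0: "\<alpha> 0 = 0"
    and alpha_less: "i < N \<Longrightarrow> \<alpha> i < \<alpha> (Suc i)"
    and coeff_pos: "i \<le> N \<Longrightarrow> a i > 0"
    and N_pos: "N \<ge> 1"
begin

abbreviation "g \<equiv> g_poly N \<alpha> a"

lemma alpha_strict_mono: "i < j \<Longrightarrow> j \<le> N \<Longrightarrow> \<alpha> i < \<alpha> j"
proof (induction j)
  case (Suc j)
  then show ?case using alpha_less[of j] by (cases "i = j") (auto simp: less_Suc_eq)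
qed simp

lemma alpha_nonneg: "i \<le> N \<Longrightarrow> \<alpha> i \<ge> 0"
  using alpha_strict_mono[of 0 i] alpha_0 by (cases "i = 0") auto

lemma alpha_le: "i \<le> N \<Longrightarrow> \<alpha> i \<le> \<alpha> N"
  using alpha_strict_mono[of i N] by (cases "i = N") auto

lemma alpha_N_pos: "\<alpha> N > 0"
  using alpha_strict_mono[of 0 N] alpha_0 N_pos by simp

lemma g_mono: "0 \<le> s \<Longrightarrow> s \<le> t \<Longrightarrow> g s \<le> g t"
  unfolding g_poly_def
  by (intro sum_mono mult_left_mono rpow_mono) (auto simp: alpha_nonneg coeff_pos less_imp_le)

lemma g_ge_sum: "s \<ge> 0 \<Longrightarrow> g s \<ge> a 0 + a N * s powr \<alpha> N"
proof -
  assume "s \<ge> 0"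
  \<comment> \<open>Only the two extreme terms are kept; N \<ge> 1 makes their indices
    distinct.\<close>
  have "(\<Sum>i\<in>{0, N}. a i * rpow s (\<alpha> i)) \<le> g s"
    unfolding g_poly_def
    by (intro sum_mono2) (auto simp: rpow_nonneg coeff_pos less_imp_le)
  then show ?thesis
    using N_pos alpha_0 alpha_N_pos by (simp add: rpow_def)
qed

lemma g_ge_a0: "s \<ge> 0 \<Longrightarrow> g s \<ge> a 0"
  using g_ge_sum[of s] coeff_pos[of N] by (smt (verit) mult_nonneg_nonneg order_refl powr_ge_zero)

lemma g_pos: "s \<ge> 0 \<Longrightarrow> g s > 0"
  using g_ge_a0[of s] coeff_pos[of 0] by simp

lemma g_ge_powr:
  assumes "s \<ge> 0"
  shows "min (a 0) (a N) / 2 powr \<alpha> N * (1 + s) powr \<alpha> N \<le> g s"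
proof -
  have "min (a 0) (a N) / 2 powr \<alpha> N * (1 + s) powr \<alpha> N
      \<le> min (a 0) (a N) / 2 powr \<alpha> N * (2 powr \<alpha> N * (1 + s powr \<alpha> N))"
    using assms alpha_N_pos coeff_pos[of 0] coeff_pos[of N]
    by (intro mult_left_mono one_plus_powr_le) auto
  also have "\<dots> = min (a 0) (a N) * 1 + min (a 0) (a N) * s powr \<alpha> N"
    by (simp add: field_simps)
  also have "\<dots> \<le> a 0 * 1 + a N * s powr \<alpha> N"
    by (intro add_mono mult_right_mono) auto
  also have "\<dots> \<le> g s"
    using g_ge_sum[OF assms] by simp
  finally show ?thesis .
qed

lemma g_le_powr: "s \<ge> 0 \<Longrightarrow> g s \<le> chi0 N \<alpha> a * (1 + s) powr \<alpha> N"
  unfolding g_poly_def chi0_eq_sum sum_distrib_right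
  by (intro sum_mono mult_left_mono rpow_le_powr)
    (auto simp: alpha_nonneg alpha_le coeff_pos less_imp_le)

lemma continuous_on_g: "continuous_on {0..} g"
  unfolding g_poly_def
  by (intro continuous_intros continuous_on_rpow) (auto simp: alpha_nonneg)

text \<open>Multiplying by s turns the i-th term of g' into \<open>\<alpha> i\<close> times the i-th
  term of g, and \<open>\<alpha> i\<close> \<le> \<open>\<alpha> N\<close>. This keeps the rank-one
  part of the derivative of \<open>F\<close> comparable to g.\<close>

lemma g_has_derivative:
  assumes "s > 0"
  obtains d where "(g has_real_derivative d) (at s)" "0 \<le> d" "s * d \<le> \<alpha> N * g s"
proof
  let ?d = "\<Sum>i\<le>N. a i * (\<alpha> i * rpow s (\<alpha> i) / s)"
  show "(g has_real_derivative ?d) (at s)"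
    unfolding g_poly_def[abs_def]
    by (intro DERIV_sum DERIV_cmult rpow_has_real_derivative assms)
  show "0 \<le> ?d"
    using assms by (intro sum_nonneg) (auto simp: rpow_nonneg alpha_nonneg coeff_pos less_imp_le)
  have "s * ?d = (\<Sum>i\<le>N. \<alpha> i * (a i * rpow s (\<alpha> i)))"
    using assms by (simp add: sum_distrib_left field_simps)
  also have "\<dots> \<le> (\<Sum>i\<le>N. \<alpha> N * (a i * rpow s (\<alpha> i)))"
    by (intro sum_mono mult_right_mono)
      (auto simp: rpow_nonneg alpha_le coeff_pos less_imp_le)
  finally show "s * ?d \<le> \<alpha> N * g s"
    by (simp add: g_poly_def sum_distrib_left)
qed

end

section \<open>The map \<open>F\<close> and its derivative\<close>

text \<open>Lagrange's identity: the squares of the cross and inner products add up to the square of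
  the product of the norms.\<close>

lemma norm_cross3: "norm (cross3 k x) \<le> norm k * norm x"
  by (rule power2_le_imp_le) (simp_all add: norm_cross_dot[symmetric])

locale darcy_map = damped_polynomial +
  fixes R :: real and k :: "real^3"
  assumes norm_k: "norm k = 1" and R_nonneg: "R \<ge> 0"
begin

abbreviation "F \<equiv> F_map N \<alpha> a R k"
abbreviation "X \<equiv> X_map N \<alpha> a R k"

lemma F_eq: "F v = g (norm v) *\<^sub>R v + R *\<^sub>R cross3 k v"
  by (simp add: F_map_def J_mat_mult)

lemma continuous_on_g_norm: "continuous_on UNIV (\<lambda>v::real^3. g (norm v))"
  by (rule continuous_on_compose2[OF continuous_on_g]) (auto intro: continuous_intros)

lemma bounded_linear_rotation: "bounded_linear (\<lambda>v. R *\<^sub>R cross3 k v)"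
  unfolding linear_conv_bounded_linear[symmetric]
  by (intro linearI) (simp_all add: cross_add_right cross_mult_right scaleR_add_right)

lemma continuous_on_F: "continuous_on UNIV F"
  unfolding F_eq[abs_def]
  by (intro continuous_intros continuous_on_g_norm
      linear_continuous_on[OF bounded_linear_rotation])

text \<open>Splitting off a_0 from g leaves a nonnegative nondecreasing weight, whose radial field
  is monotone. The rotation is skew and drops out, and the a_0 part gives the quadratic
  term.\<close>

lemma F_monotone: "a 0 * (norm (v - w))\<^sup>2 \<le> (F v - F w) \<bullet> (v - w)"
proof -
  let ?p = "g (norm v) - a 0" and ?q = "g (norm w) - a 0"
  have pq: "?p \<ge> 0" "?q \<ge> 0"
    using g_ge_a0 by auto
  \<comment> \<open>Both factors have the same sign because (g(s) - a_0) s is nondecreasing.\<close>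
  have "0 \<le> (?p * norm v - ?q * norm w) * (norm v - norm w)"
  proof (cases "norm v \<le> norm w")
    case True
    then have "?p * norm v \<le> ?q * norm w"
      using pq g_mono[of "norm v" "norm w"] by (intro mult_mono) auto
    with True show ?thesis by (simp add: mult_nonpos_nonpos)
  next
    case False
    then have "?q * norm w \<le> ?p * norm v"
      using pq g_mono[of "norm w" "norm v"] by (intro mult_mono) auto
    with False show ?thesis by simp
  qed
  also have "\<dots> = ?p * (norm v)\<^sup>2 + ?q * (norm w)\<^sup>2 - (?p + ?q) * (norm v * norm w)"
    by (simp add: algebra_simps power2_eq_square)
  also have "\<dots> \<le> ?p * (norm v)\<^sup>2 + ?q * (norm w)\<^sup>2 - (?p + ?q) * (v \<bullet> w)"
    using pq by (intro diff_left_mono mult_left_mono norm_cauchy_schwarz) auto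
  also have "\<dots> = (?p *\<^sub>R v - ?q *\<^sub>R w) \<bullet> (v - w)"
    by (simp add: power2_norm_eq_inner inner_diff_left inner_diff_right inner_commute algebra_simps)
  finally have *: "0 \<le> (?p *\<^sub>R v - ?q *\<^sub>R w) \<bullet> (v - w)" .
  have "F v - F w = (?p *\<^sub>R v - ?q *\<^sub>R w) + a 0 *\<^sub>R (v - w) + R *\<^sub>R cross3 k (v - w)"
    by (simp add: F_eq cross3_simps algebra_simps)
  then have "(F v - F w) \<bullet> (v - w)
      = (?p *\<^sub>R v - ?q *\<^sub>R w) \<bullet> (v - w) + a 0 * (norm (v - w))\<^sup>2"
    by (simp only: inner_add_left inner_scaleR_left dot_cross_self power2_norm_eq_inner)
  with * show ?thesis by simp
qed

lemma F_expanding: "a 0 * dist v w \<le> dist (F v) (F w)"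
proof (cases "v = w")
  case False
  have "a 0 * norm (v - w) * norm (v - w) \<le> norm (F v - F w) * norm (v - w)"
    using F_monotone[of v w] norm_cauchy_schwarz[of "F v - F w" "v - w"]
    by (simp add: power2_eq_square)
  then show ?thesis using False by (simp add: dist_norm)
qed simp

lemma a0_pos: "a 0 > 0"
  by (simp add: coeff_pos)

lemma bij_F: "bij F"
  using expanding_imp_bij[OF continuous_on_F a0_pos F_expanding] .

lemma F_X: "F (X y) = y"
  using bij_F by (simp add: X_map_def bij_is_surj surj_f_inv_f)

text \<open>Away from the origin c = g'(|v|)/|v|. At the origin, where g' may blow up, c = 0 and the
  derivative is computed directly.\<close>

lemma radial_has_derivative:
  obtains c where "0 \<le> c" "c * (norm v)\<^sup>2 \<le> \<alpha> N * g (norm v)"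
    "((\<lambda>v::real^3. g (norm v) *\<^sub>R v) has_derivative
      (\<lambda>h. g (norm v) *\<^sub>R h + (c * (v \<bullet> h)) *\<^sub>R v)) (at v)"
proof (cases "v = 0")
  case True
  have "((\<lambda>h::real^3. (g (norm h) - g 0)) \<longlongrightarrow> 0) (at 0)"
    using continuous_on_g_norm
    by (auto simp: continuous_on_eq_continuous_at isCont_def intro!: LIM_zero)
      (metis norm_zero)
  \<comment> \<open>This product is the difference quotient of the remainder: a null factor times a
    vector of norm at most 1.\<close>
  then have "((\<lambda>h::real^3. (g (norm h) - g 0) *\<^sub>R sgn h) \<longlongrightarrow> 0) (at 0)"
    by (rule lim_null_scaleR_bounded[where B = 1]) (auto simp: norm_sgn)
  then have "((\<lambda>h::real^3. (g (norm h) *\<^sub>R h - g 0 *\<^sub>R h) /\<^sub>R norm h) \<longlongrightarrow> 0) (at 0)"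
    by (simp add: sgn_div_norm scaleR_diff_left[symmetric] mult.commute)
  then have "((\<lambda>h::real^3. norm (g (norm h) *\<^sub>R h - g 0 *\<^sub>R h) / norm h) \<longlongrightarrow> 0) (at 0)"
    by (drule_tac tendsto_norm_zero) (simp add: divide_inverse mult.commute)
  then have "((\<lambda>v::real^3. g (norm v) *\<^sub>R v) has_derivative (\<lambda>h. g 0 *\<^sub>R h)) (at 0)"
    by (simp add: has_derivative_at bounded_linear_scaleR_right)
  then show ?thesis
    using True that[of 0] alpha_N_pos g_pos[of 0] by (simp add: less_imp_le)
next
  case False
  then have s: "norm v > 0" by simp
  obtain d where d: "(g has_real_derivative d) (at (norm v))" "0 \<le> d"
      "norm v * d \<le> \<alpha> N * g (norm v)"
    using g_has_derivative[OF s] .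
  have "((\<lambda>v::real^3. g (norm v)) has_derivative (\<lambda>h. d * (h \<bullet> sgn v))) (at v)"
    using has_derivative_compose[OF has_derivative_norm[OF False]
        d(1)[unfolded has_field_derivative_def]] by simp
  then have "((\<lambda>v::real^3. g (norm v) *\<^sub>R v) has_derivative
      (\<lambda>h. g (norm v) *\<^sub>R h + (d * (h \<bullet> sgn v)) *\<^sub>R v)) (at v)"
    using has_derivative_scaleR[OF _ has_derivative_ident] by blast
  moreover have "d * (h \<bullet> sgn v) = d / norm v * (v \<bullet> h)" for h
    by (simp add: sgn_div_norm inner_commute divide_inverse)
  ultimately show ?thesis
    using that[of "d / norm v"] d s by (simp add: power2_eq_square mult.commute)
qed

lemma F_has_derivative:
  obtains F' where "(F has_derivative F') (at v)"
    "\<And>h. g (norm v) * (norm h)\<^sup>2 \<le> F' h \<bullet> h"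
    "\<And>h. norm (F' h) \<le> ((1 + \<alpha> N) * g (norm v) + R) * norm h"
proof -
  obtain c where c: "0 \<le> c" "c * (norm v)\<^sup>2 \<le> \<alpha> N * g (norm v)"
    and der: "((\<lambda>v::real^3. g (norm v) *\<^sub>R v) has_derivative
      (\<lambda>h. g (norm v) *\<^sub>R h + (c * (v \<bullet> h)) *\<^sub>R v)) (at v)"
    using radial_has_derivative .
  define F' where
    "F' h = g (norm v) *\<^sub>R h + (c * (v \<bullet> h)) *\<^sub>R v + R *\<^sub>R cross3 k h" for h
  have "(F has_derivative F') (at v)"
    unfolding F_eq[abs_def] F'_def[abs_def]
    using has_derivative_add[OF der bounded_linear_imp_has_derivative[OF bounded_linear_rotation]] .
  moreover have "g (norm v) * (norm h)\<^sup>2 \<le> F' h \<bullet> h" for h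
  proof -
    \<comment> \<open>The cross product with k is orthogonal to h, and the rank-one part contributes
      a nonnegative square.\<close>
    have "F' h \<bullet> h = g (norm v) * (norm h)\<^sup>2 + c * (v \<bullet> h)\<^sup>2"
      by (simp add: F'_def inner_add_left dot_cross_self power2_norm_eq_inner)
        (simp add: power2_eq_square)
    then show ?thesis using c by simp
  qed
  moreover have "norm (F' h) \<le> ((1 + \<alpha> N) * g (norm v) + R) * norm h" for h
  proof -
    have "norm (g (norm v) *\<^sub>R h) = g (norm v) * norm h"
      using g_pos[of "norm v"] by simp
    moreover have "norm ((c * (v \<bullet> h)) *\<^sub>R v) \<le> \<alpha> N * g (norm v) * norm h"
    proof -
      have "norm ((c * (v \<bullet> h)) *\<^sub>R v) = c * \<bar>v \<bullet> h\<bar> * norm v"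
        using c by (simp add: abs_mult)
      also have "\<dots> \<le> c * (norm v * norm h) * norm v"
        using c by (intro mult_right_mono mult_left_mono Cauchy_Schwarz_ineq2) auto
      also have "\<dots> = c * (norm v)\<^sup>2 * norm h"
        by (simp add: power2_eq_square)
      also have "\<dots> \<le> \<alpha> N * g (norm v) * norm h"
        using c by (intro mult_right_mono) auto
      finally show ?thesis .
    qed
    moreover have "norm (R *\<^sub>R cross3 k h) \<le> R * norm h"
      using R_nonneg norm_cross3[of k h] norm_k by (simp add: mult_left_mono)
    ultimately have "norm (F' h) \<le> g (norm v) * norm h + \<alpha> N * g (norm v) * norm h + R * norm h"
      unfolding F'_def by (intro norm_triangle_mono) (simp_all only: order_refl)
    then show ?thesis by (simp add: algebra_simps)
  qed
  ultimately show thesis using that by blast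
qed

text \<open>With F' the derivative of \<open>F\<close> at \<open>X y\<close>, one has F' \<eta> =
  \<xi>, so all three bounds come from the estimates for F' tested on \<eta>.\<close>

lemma X_deriv_bounds:
  fixes y \<xi> :: "real^3"
  defines "s \<equiv> norm (X y)" and "\<eta> \<equiv> X_deriv N \<alpha> a R k y *v \<xi>"
  shows "norm \<eta> \<le> norm \<xi> / g s"
    and "norm \<xi> \<le> ((1 + \<alpha> N) * g s + R) * norm \<eta>"
    and "g s * (norm \<eta>)\<^sup>2 \<le> \<xi> \<bullet> \<eta>"
proof -
  have gs: "g s > 0" by (simp add: s_def g_pos)
  obtain F' where der: "(F has_derivative F') (at (X y))"
    and coercive: "\<And>h. g s * (norm h)\<^sup>2 \<le> F' h \<bullet> h"
    and bound: "\<And>h. norm (F' h) \<le> ((1 + \<alpha> N) * g s + R) * norm h"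
    unfolding s_def using F_has_derivative[of "X y"] by blast
  have "inj F'"
  proof -
    have "h = 0" if "F' h = 0" for h
      using coercive[of h] that gs by (simp add: mult_le_0_iff)
    then show ?thesis
      using linear_injective_0[OF has_derivative_linear[OF der]] by blast
  qed
  then obtain X' where X': "(X has_derivative X') (at y)" "\<And>x. F' (X' x) = x"
    using expanding_inv_has_derivative[OF bij_F a0_pos F_expanding der[unfolded X_map_def]]
    unfolding X_map_def by blast
  \<comment> \<open>Differentiability makes the Jacobian a derivative; uniqueness then identifies it
    with the inverse of F'.\<close>
  have "(X has_derivative (\<lambda>h. X_deriv N \<alpha> a R k y *v h)) (at y)"
    using X'(1) jacobian_works[of X "at y"] unfolding X_deriv_def
    by (auto intro: differentiableI)
  then have "X' \<xi> = \<eta>"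
    using has_derivative_unique[OF X'(1)] by (simp add: \<eta>_def fun_eq_iff)
  then have F'\<eta>: "F' \<eta> = \<xi>"
    using X'(2) by auto
  show "norm \<xi> \<le> ((1 + \<alpha> N) * g s + R) * norm \<eta>"
    using bound[of \<eta>] F'\<eta> by simp
  show energy: "g s * (norm \<eta>)\<^sup>2 \<le> \<xi> \<bullet> \<eta>"
    using coercive[of \<eta>] F'\<eta> by simp
  have "g s * norm \<eta> * norm \<eta> \<le> norm \<xi> * norm \<eta>"
    using energy norm_cauchy_schwarz[of \<xi> \<eta>] by (simp add: power2_eq_square)
  then have "g s * norm \<eta> \<le> norm \<xi>"
    by (cases "\<eta> = 0") auto
  then show "norm \<eta> \<le> norm \<xi> / g s"
    using gs by (simp add: field_simps)
qed

section \<open>Growth of \<open>F\<close> and comparison of 1 + |y| with 1 + |X y|\<close>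

abbreviation "chi \<equiv> chi1 N \<alpha> a R"

lemma chi1_pos: "chi > 0" and chi1_ge_R: "R \<le> chi"
  using g_pos[of 1] R_nonneg by (auto simp: chi1_def chi0_def)

lemma norm_F_bounds:
  shows "1 + norm (F v) \<le> (1 + chi) * (1 + norm v) powr (1 + \<alpha> N)"
    and "2 powr (- \<alpha> N) * min 1 (a N) * (1 + norm v) powr (1 + \<alpha> N) \<le> 1 + norm (F v)"
proof -
  define s where "s = norm v"
  have s: "s \<ge> 0" by (simp add: s_def)
  have ge1: "1 \<le> (1 + s) powr p" if "p \<ge> 0" for p
    using s that by (simp add: ge_one_powr_ge_zero)
  have "norm (F v) \<le> g s * s + R * s"
    unfolding F_eq using g_pos[OF s] R_nonneg norm_cross3[of k v] norm_k
    by (intro norm_triangle_le add_mono) (auto simp: s_def mult_left_mono)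
  also have "\<dots> = (g s + R) * s"
    by (simp add: algebra_simps)
  \<comment> \<open>R is padded by a power that is at least 1, so that both coefficients merge into
    \<open>chi\<close>.\<close>
  also have "\<dots> \<le> (chi0 N \<alpha> a * (1 + s) powr \<alpha> N + R * (1 + s) powr \<alpha> N) * (1 + s)"
    using s g_le_powr[OF s] g_pos[OF s] R_nonneg ge1[of "\<alpha> N"] alpha_N_pos
    by (intro mult_mono add_mono) (auto simp: mult_le_cancel_left1)
  also have "\<dots> = chi * (1 + s) powr (1 + \<alpha> N)"
    using s by (simp add: chi1_def powr_add algebra_simps)
  finally show "1 + norm (F v) \<le> (1 + chi) * (1 + norm v) powr (1 + \<alpha> N)"
    using ge1[of "1 + \<alpha> N"] alpha_N_pos by (simp add: s_def algebra_simps)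
  \<comment> \<open>Pairing \<open>F v\<close> with v removes the rotation, so R does not enter the
    lower bound.\<close>
  have low: "a N * s powr (1 + \<alpha> N) \<le> norm (F v)"
  proof (cases "s = 0")
    case False
    have "F v \<bullet> v = g s * (norm v)\<^sup>2"
      by (simp add: F_eq inner_add_left dot_cross_self power2_norm_eq_inner s_def)
    then have "g s * s * s \<le> norm (F v) * s"
      using norm_cauchy_schwarz[of "F v" v] by (simp add: s_def power2_eq_square)
    then have "g s * s \<le> norm (F v)"
      using False s by simp
    moreover have "a N * s powr \<alpha> N * s \<le> g s * s"
      using g_ge_sum[OF s] a0_pos s by (intro mult_right_mono) auto
    ultimately have "a N * s powr \<alpha> N * s \<le> norm (F v)"
      by linarith
    then show ?thesis
      using s False by (simp add: powr_add mult_ac)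
  qed simp
  let ?m = "min 1 (a N)"
  have m: "?m \<ge> 0" using coeff_pos[of N] by simp
  have "2 powr (- \<alpha> N) * ?m * (1 + s) powr (1 + \<alpha> N)
      \<le> 2 powr (- \<alpha> N) * ?m * (2 powr (1 + \<alpha> N - 1) * (1 + s powr (1 + \<alpha> N)))"
    using s m alpha_N_pos by (intro mult_left_mono one_plus_powr_le_convex) auto
  also have "\<dots> = ?m * 1 + ?m * s powr (1 + \<alpha> N)"
    by (simp add: powr_minus field_simps)
  also have "\<dots> \<le> 1 * 1 + a N * s powr (1 + \<alpha> N)"
    by (intro add_mono mult_right_mono) auto
  also have "\<dots> \<le> 1 + norm (F v)"
    using low by simp
  finally show "2 powr (- \<alpha> N) * ?m * (1 + norm v) powr (1 + \<alpha> N) \<le> 1 + norm (F v)"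
    by (simp add: s_def)
qed

abbreviation "q \<equiv> exp_a N \<alpha>"

lemma exp_a_pos: "q > 0"
  using alpha_N_pos by (simp add: exp_a_def)

text \<open>The exponent \<open>q\<close> satisfies (1 + \<open>\<alpha> N\<close>) q =
  \<open>\<alpha> N\<close>: it converts the growth degree of \<open>F\<close> into that of
  g.\<close>

lemma powr_exp_a: "(c powr (1 + \<alpha> N)) powr q = c powr \<alpha> N"
  using alpha_N_pos by (simp add: powr_powr exp_a_def)

lemma one_plus_norm_powr_le:
  "(1 + norm y) powr q \<le> (1 + chi) powr q * (1 + norm (X y)) powr \<alpha> N"
proof -
  have "(1 + norm y) powr q \<le> ((1 + chi) * (1 + norm (X y)) powr (1 + \<alpha> N)) powr q"
    using norm_F_bounds(1)[of "X y"] exp_a_pos by (intro powr_mono2) (auto simp: F_X)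
  then show ?thesis
    using chi1_pos by (simp add: powr_mult powr_exp_a)
qed

lemma one_plus_norm_powr_ge:
  "(2 powr (- \<alpha> N) * min 1 (a N)) powr q * (1 + norm (X y)) powr \<alpha> N \<le> (1 + norm y) powr q"
proof -
  have "(2 powr (- \<alpha> N) * min 1 (a N) * (1 + norm (X y)) powr (1 + \<alpha> N)) powr q
      \<le> (1 + norm y) powr q"
    using norm_F_bounds(2)[of "X y"] exp_a_pos coeff_pos[of N]
    by (intro powr_mono2) (auto simp: F_X)
  then show ?thesis
    using coeff_pos[of N] by (simp add: powr_mult powr_exp_a)
qed

text \<open>Both g s and R are at most \<open>chi\<close> times the power. They enter with weights 1
  + \<open>\<alpha> N\<close> and 1, whence the factor \<open>\<alpha> N + 2\<close> in
  \<open>c6\<close> and \<open>c8\<close>.\<close>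

lemma F_deriv_norm_le:
  assumes "s \<ge> 0"
  shows "(1 + \<alpha> N) * g s + R \<le> (\<alpha> N + 2) * chi * (1 + s) powr \<alpha> N"
proof -
  let ?P = "(1 + s) powr \<alpha> N"
  have P: "1 \<le> ?P"
    using assms alpha_N_pos by (simp add: ge_one_powr_ge_zero)
  have "g s \<le> chi * ?P"
    using g_le_powr[OF assms] R_nonneg P by (simp add: chi1_def distrib_right add_increasing2)
  moreover have "R \<le> chi * ?P"
    using chi1_ge_R chi1_pos P by (smt (verit) mult_le_cancel_left1)
  ultimately have "(1 + \<alpha> N) * g s + R \<le> (1 + \<alpha> N) * (chi * ?P) + chi * ?P"
    using alpha_N_pos by (intro add_mono mult_left_mono) auto
  then show ?thesis by (simp add: algebra_simps)
qed

end

text \<open>Testing on the unit basis vectors bounds every column from below, and the squared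
  Frobenius norm sums the squared column norms. Three columns give the factor sqrt 3 in
  \<open>c6\<close>.\<close>

lemma norm_mat_ge_of_mult_ge:
  fixes A :: "real^'n^'m"
  assumes "b \<ge> 0" and "\<And>x. b * norm x \<le> norm (A *v x)"
  shows "sqrt (real CARD('n)) * b \<le> norm A"
proof -
  have "real CARD('n) * b\<^sup>2 = (\<Sum>j\<in>(UNIV::'n set). b\<^sup>2)" by simp
  also have "\<dots> \<le> (\<Sum>j\<in>UNIV. (norm (column j A))\<^sup>2)"
  proof (rule sum_mono)
    fix j :: 'n
    have "b \<le> norm (column j A)"
      using assms(2)[of "axis j 1"] by (simp add: matrix_vector_mult_basis norm_axis_1)
    then show "b\<^sup>2 \<le> (norm (column j A))\<^sup>2"
      using \<open>b \<ge> 0\<close> by (simp add: power_mono)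
  qed
  also have "\<dots> = (\<Sum>j\<in>UNIV. \<Sum>i\<in>UNIV. (A $ i $ j)\<^sup>2)"
    by (simp add: norm_vec_def L2_set_def column_def sum_nonneg)
  also have "\<dots> = (\<Sum>i\<in>UNIV. \<Sum>j\<in>UNIV. (A $ i $ j)\<^sup>2)"
    by (rule sum.swap)
  also have "\<dots> = (norm A)\<^sup>2"
    by (simp add: norm_vec_def L2_set_def sum_nonneg)
  finally have "sqrt (real CARD('n) * b\<^sup>2) \<le> norm A"
    by (simp add: real_le_lsqrt)
  then show ?thesis
    using \<open>b \<ge> 0\<close> by (simp add: real_sqrt_mult)
qed

section \<open>Assembly of the matrix estimates from the pointwise bounds\<close>

theorem lemma2p4:
  fixes N :: nat and \<alpha> a :: "nat \<Rightarrow> real" and R cs :: real and k y :: "real^3"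
  assumes "N \<ge> 1"
    and "\<alpha> 0 = 0"
    and "\<forall>i<N. \<alpha> i < \<alpha> (Suc i)"
    and "\<forall>i\<le>N. a i > 0"
    and "norm k = 1"
    and "R \<ge> 0"
    and "cs > 0"
    and "\<forall>A :: real^3^3. norm A \<le> cs * onorm ((*v) A)"
  shows "c6 N \<alpha> a * inverse (chi1 N \<alpha> a R) * (1 + norm y) powr (- exp_a N \<alpha>)
           \<le> norm (X_deriv N \<alpha> a R k y)
       \<and> norm (X_deriv N \<alpha> a R k y)
           \<le> c7 N \<alpha> a cs * (1 + chi1 N \<alpha> a R) powr (exp_a N \<alpha>) * (1 + norm y) powr (- exp_a N \<alpha>)
       \<and> (\<forall>\<xi> :: real^3. \<xi> \<bullet> (X_deriv N \<alpha> a R k y *v \<xi>)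
           \<ge> c8 N \<alpha> a * inverse ((chi1 N \<alpha> a R)\<^sup>2) * (1 + norm y) powr (- exp_a N \<alpha>) * (norm \<xi>)\<^sup>2)"
proof -
  interpret darcy_map N \<alpha> a R k
    using assms by unfold_locales auto
  let ?A = "X_deriv N \<alpha> a R k y"
  \<comment> \<open>The estimates reduce to relations between \<open>P\<close> and \<open>Y\<close>,
    the powers of 1 + |X y| and 1 + |y|. \<open>M\<close> and \<open>m\<close> are the lower
    comparison constants for \<open>Y\<close> and g s, and \<open>L\<close> bounds the operator norm
    of the derivative of \<open>F\<close>.\<close>
  define s where "s = norm (X y)"
  define P where "P = (1 + s) powr \<alpha> N"
  define Y where "Y = (1 + norm y) powr q"
  define M where "M = (2 powr (- \<alpha> N) * min 1 (a N)) powr q"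
  define m where "m = min (a 0) (a N) / 2 powr \<alpha> N"
  define L where "L = (1 + \<alpha> N) * g s + R"
  have s: "s \<ge> 0" by (simp add: s_def)
  have P: "P > 0" using s by (auto simp: P_def)
  have Y: "Y > 0" by (auto simp: Y_def add_nonneg_eq_0_iff)
  have invY: "(1 + norm y) powr (- q) = 1 / Y"
    by (simp add: Y_def powr_minus_divide)
  have M: "M > 0" using coeff_pos[of N] by (simp add: M_def)
  have m: "m > 0" using coeff_pos[of N] a0_pos by (simp add: m_def)
  have gs: "g s > 0" using g_pos[OF s] .
  have L: "L > 0"
    using gs alpha_N_pos R_nonneg by (auto simp: L_def intro!: add_pos_nonneg)
  have L_le: "L \<le> (\<alpha> N + 2) * chi * P"
    using F_deriv_norm_le[OF s] by (simp add: L_def P_def)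
  have MP: "M * P \<le> Y"
    using one_plus_norm_powr_ge[of y] by (simp add: M_def P_def Y_def s_def)
  have mP: "m * P \<le> g s"
    using g_ge_powr[OF s] by (simp add: m_def P_def)
  have Y_le: "Y \<le> (1 + chi) powr q * P"
    using one_plus_norm_powr_le[of y] by (simp add: P_def Y_def s_def)
  have al2: "\<alpha> N + 2 > 0" using alpha_N_pos by simp
  have lower: "norm \<xi> \<le> L * norm (?A *v \<xi>)" for \<xi>
    using X_deriv_bounds(2)[of \<xi> y] by (simp add: L_def s_def)

  have "c6 N \<alpha> a * inverse chi * (1 + norm y) powr (- q) \<le> norm ?A"
  proof -
    have "M * L \<le> (\<alpha> N + 2) * chi * (M * P)"
      using mult_left_mono[OF L_le, of M] M by (simp add: mult_ac)
    also have "\<dots> \<le> (\<alpha> N + 2) * chi * Y"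
      using MP al2 chi1_pos by (intro mult_left_mono) auto
    finally have "M / ((\<alpha> N + 2) * chi * Y) \<le> 1 / L"
      using al2 chi1_pos Y L by (simp add: divide_simps mult_ac)
    then have "sqrt 3 * (M / ((\<alpha> N + 2) * chi * Y)) \<le> sqrt 3 * (1 / L)"
      by (intro mult_left_mono) auto
    also have "\<dots> \<le> norm ?A"
      using norm_mat_ge_of_mult_ge[of "1 / L" ?A] lower L by (simp add: field_simps)
    finally show ?thesis
      unfolding c6_def M_def[symmetric] invY by (simp add: divide_inverse mult_ac)
  qed
  moreover have "norm ?A \<le> c7 N \<alpha> a cs * (1 + chi) powr q * (1 + norm y) powr (- q)"
  proof -
    \<comment> \<open>The chain bounds g s below by \<open>P\<close> and then \<open>P\<close> below
      by \<open>Y\<close>; \<open>cs\<close> passes to the Frobenius norm.\<close>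
    have "onorm ((*v) ?A) \<le> 1 / g s"
      using X_deriv_bounds(1)[of y] by (intro onorm_le) (simp add: s_def)
    also have "\<dots> \<le> 1 / (m * P)"
      using mP m P gs by (intro divide_left_mono) auto
    also have "\<dots> \<le> (1 + chi) powr q / (m * Y)"
      using Y_le m P Y by (simp add: divide_simps mult_ac)
    finally have "cs * onorm ((*v) ?A) \<le> cs * ((1 + chi) powr q / (m * Y))"
      using \<open>cs > 0\<close> by (intro mult_left_mono) auto
    then have "norm ?A \<le> cs * ((1 + chi) powr q / (m * Y))"
      using assms(8) order_trans by blast
    then show ?thesis
      by (simp add: c7_def m_def invY mult_ac)
  qed
  moreover have "c8 N \<alpha> a * inverse (chi\<^sup>2) * (1 + norm y) powr (- q) * (norm \<xi>)\<^sup>2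
      \<le> \<xi> \<bullet> (?A *v \<xi>)" for \<xi>
  proof -
    \<comment> \<open>\<open>b\<close> is the base of the power in \<open>c4\<close>, which factors
      as b times b^q; these factors lie below \<open>m\<close> and \<open>M\<close>
      respectively.\<close>
    define b where "b = min 1 (min (a 0) (a N)) / 2 powr \<alpha> N"
    have b: "b > 0" using coeff_pos[of N] a0_pos by (simp add: b_def)
    have "b powr q \<le> M"
      unfolding M_def using b exp_a_pos
      by (intro powr_mono2) (auto simp: b_def powr_minus_divide divide_right_mono)
    moreover have "b \<le> m"
      unfolding b_def m_def by (intro divide_right_mono) auto
    ultimately have "b * b powr q \<le> m * M"
      using b m by (intro mult_mono) auto
    then have c4: "c4 N \<alpha> a \<le> m * M"
      using b by (simp add: c4_def b_def[symmetric] powr_add)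
    define K where "K = ((\<alpha> N + 2) * chi)\<^sup>2"
    have K: "K > 0" using al2 chi1_pos by (simp add: K_def)
    have "c4 N \<alpha> a * L\<^sup>2 \<le> m * M * ((\<alpha> N + 2) * chi * P)\<^sup>2"
      using c4 L_le L m M by (intro mult_mono power_mono) auto
    \<comment> \<open>One factor \<open>P\<close> is to be absorbed by g s and the other by
      \<open>Y\<close>, so a single power of \<open>Y\<close> remains although \<open>L\<close> is
      squared.\<close>
    also have "\<dots> = (m * P) * (M * P) * K"
      by (simp add: power2_eq_square K_def)
    also have "\<dots> \<le> g s * Y * K"
      using mP MP gs m M P K by (intro mult_right_mono mult_mono) auto
    finally have "c4 N \<alpha> a / (K * Y) \<le> g s / L\<^sup>2"
      using K Y L by (simp add: pos_divide_le_eq pos_le_divide_eq mult_ac)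
    then have "c4 N \<alpha> a / (K * Y) * (norm \<xi>)\<^sup>2 \<le> g s / L\<^sup>2 * (norm \<xi>)\<^sup>2"
      by (intro mult_right_mono) auto
    \<comment> \<open>Bounding |\<xi>| by the image norm cancels \<open>L\<close> and leaves the
      left side of the energy inequality.\<close>
    also have "\<dots> \<le> g s / L\<^sup>2 * (L * norm (?A *v \<xi>))\<^sup>2"
      using lower gs by (intro mult_left_mono power_mono) auto
    also have "\<dots> = g s * (norm (?A *v \<xi>))\<^sup>2"
      using L by (simp add: power_mult_distrib)
    also have "\<dots> \<le> \<xi> \<bullet> (?A *v \<xi>)"
      using X_deriv_bounds(3)[of y \<xi>] by (simp add: s_def)
    finally show ?thesis
      unfolding c8_def invY by (simp add: K_def power_mult_distrib divide_inverse mult_ac)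
  qed
  ultimately show ?thesis by blast
qed

end
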